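(* Let $n\ge1$, let $\rho_1,\rho_2\in\mathcal{D}(n)$, and let $U,V\in\mathrm{U}(n)$ be such that $UV^*$ is the unitary polar factor of $\rho_2^{1/2}\rho_1^{1/2}$. For $t\in[0,1]$ put $$\gamma(t)=(1-t)\rho_1^{1/2}V+t\,\rho_2^{1/2}U,\qquad \tilde\gamma(t)=\frac{\gamma(t)}{\|\gamma(t)\|_2},$$ and let $\pi(M)=MM^*$ for $M\in\mathrm{GL}(n)$. Then $\pi\circ\tilde\gamma$ is an unnormalised geodesic between $\rho_1$ and $\rho_2$ in $(\mathcal{D}(n),\mathfrak{g}^{BW})$.
   Context: $\mathrm{GL}(n)$ is the group of invertible complex $n\times n$ matrices and $\mathrm{U}(n)$ the unitary group. $\|A\|_2=(\operatorname{tr}(AA^* ))^{1/2}$. $\mathbb{H}(n)$ denotes the Hermitian $n\times n$ complex matrices, $\mathbb{P}(n)\subset\mathbb{H}(n)$ the positive-definite ones, and $\mathcal{D}(n)=\{\rho\in\mathbb{P}(n):\operatorname{tr}\rho=1\}$. Square roots of positive-definite matrices are the positive-definite ones. The unitary polar factor of $M\in\mathrm{GL}(n)$ is the unitary matrix $M(M^*M)^{-1/2}$. Tangent spaces are identified with matrices: $T_\Sigma\mathbb{P}(n)\cong\mathbb{H}(n)$ and $T_\rho\mathcal{D}(n)\cong\{H\in\mathbb{H}(n):\operatorname{tr}H=0\}$. For $\Sigma\in\mathbb{P}(n)$ and $H\in\mathbb{H}(n)$, $\mathcal{L}_\Sigma(H)$ is the unique solution $X$ of $\Sigma X+X\Sigma=H$.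 The Bures-Wasserstein metric on $\mathbb{P}(n)$ is $\mathfrak{g}^{BW}_\Sigma(H,K)=\tfrac12\operatorname{Re}\operatorname{tr}(\mathcal{L}_\Sigma(H)K)$ for $H,K\in T_\Sigma\mathbb{P}(n)$; $(\mathcal{D}(n),\mathfrak{g}^{BW})$ carries its restriction to the submanifold $\mathcal{D}(n)$. "Unnormalised geodesic" means a curve that is a Riemannian geodesic up to reparametrisation (it need not have constant speed). *)

theory Defs
  imports "HOL-Analysis.Analysis"
begin

section \<open>Complex matrices\<close>

definition adj :: "complex^'n^'n \<Rightarrow> complex^'n^'n" where
  "adj A = map_matrix cnj (transpose A)"

definition unitary :: "complex^'n^'n \<Rightarrow> bool" where
  "unitary A \<longleftrightarrow> A ** adj A = mat 1 \<and> adj A ** A = mat 1"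

definition hs_norm :: "complex^'n^'n \<Rightarrow> real" where
  "hs_norm A = sqrt (Re (trace (A ** adj A)))"

definition hermitian_matrices :: "(complex^'n^'n) set" where
  "hermitian_matrices = {A. adj A = A}"

definition posdef_matrices :: "(complex^'n^'n) set" where
  "posdef_matrices =
     {A \<in> hermitian_matrices. \<forall>x. x \<noteq> 0 \<longrightarrow> 0 < Re (\<Sum>i\<in>UNIV. cnj (x $ i) * (A *v x) $ i)}"

definition density_matrices :: "(complex^'n^'n) set" where
  "density_matrices = {\<rho> \<in> posdef_matrices. trace \<rho> = 1}"

definition traceless_hermitian :: "(complex^'n^'n) set" where
  "traceless_hermitian = {H \<in> hermitian_matrices. trace H = 0}"

definition posdef_sqrt :: "complex^'n^'n \<Rightarrow> complex^'n^'n" where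
  "posdef_sqrt A = (THE R. R \<in> posdef_matrices \<and> R ** R = A)"

definition polar_factor :: "complex^'n^'n \<Rightarrow> complex^'n^'n" where
  "polar_factor M = M ** matrix_inv (posdef_sqrt (adj M ** M))"

section \<open>The Bures-Wasserstein metric\<close>

definition lyapunov :: "complex^'n^'n \<Rightarrow> complex^'n^'n \<Rightarrow> complex^'n^'n" where
  "lyapunov \<Sigma> H = (THE X. \<Sigma> ** X + X ** \<Sigma> = H)"

definition bw_metric :: "complex^'n^'n \<Rightarrow> complex^'n^'n \<Rightarrow> complex^'n^'n \<Rightarrow> real" where
  "bw_metric \<Sigma> H K = Re (trace (lyapunov \<Sigma> H ** K)) / 2"

section \<open>Geodesics on open subsets of affine subspaces\<close>

text \<open>
  Throughout, \<open>M\<close> is a relatively open subset of an affine subspace with direction space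
  \<open>T\<close>, so that every tangent space of \<open>M\<close> is \<open>T\<close>, and \<open>g p\<close> is the inner
  product on \<open>T\<close> at \<open>p\<close>.  The ambient affine coordinates form a global chart.
  The constant vector fields commute, so the Koszul formula for them reduces to
  \<open>2 g(\<nabla>\<^sub>u v, w) = D\<^sub>u (g(v,w)) + D\<^sub>v (g(u,w)) - D\<^sub>w (g(u,v))\<close>;
  \<open>christoffel T g p u v\<close> is the vector \<open>\<nabla>\<^sub>u v\<close> at \<open>p\<close> for the
  Levi-Civita connection of \<open>g\<close> on \<open>M\<close>.  Only directions \<open>w\<close> in \<open>T\<close> are tested,
  so this is the connection of the metric restricted to \<open>M\<close>.
\<close>

definition dir_deriv :: "('a::real_vector \<Rightarrow> real) \<Rightarrow> 'a \<Rightarrow> 'a \<Rightarrow> real" where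
  "dir_deriv f p u = deriv (\<lambda>s::real. f (p + s *\<^sub>R u)) 0"

definition christoffel_first ::
  "('a::real_vector \<Rightarrow> 'a \<Rightarrow> 'a \<Rightarrow> real) \<Rightarrow> 'a \<Rightarrow> 'a \<Rightarrow> 'a \<Rightarrow> 'a \<Rightarrow> real" where
  "christoffel_first g p u v w =
     (dir_deriv (\<lambda>q. g q v w) p u + dir_deriv (\<lambda>q. g q u w) p v - dir_deriv (\<lambda>q. g q u v) p w) / 2"

definition christoffel ::
  "'a::real_vector set \<Rightarrow> ('a \<Rightarrow> 'a \<Rightarrow> 'a \<Rightarrow> real) \<Rightarrow> 'a \<Rightarrow> 'a \<Rightarrow> 'a \<Rightarrow> 'a" where
  "christoffel T g p u v = (THE x. x \<in> T \<and> (\<forall>w\<in>T. g p x w = christoffel_first g p u v w))"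

definition smooth_curve_on :: "real set \<Rightarrow> (real \<Rightarrow> 'a::real_normed_vector) \<Rightarrow> bool" where
  "smooth_curve_on S c \<longleftrightarrow>
     (\<exists>D :: nat \<Rightarrow> real \<Rightarrow> 'a. (\<forall>t\<in>S. D 0 t = c t) \<and>
        (\<forall>k. \<forall>t\<in>S. (D k has_vector_derivative D (Suc k) t) (at t within S)))"

definition velocity :: "real set \<Rightarrow> (real \<Rightarrow> 'a::real_normed_vector) \<Rightarrow> real \<Rightarrow> 'a" where
  "velocity S c t = vector_derivative c (at t within S)"

text \<open>The covariant derivative of the velocity of \<open>c\<close> along \<open>c\<close>.\<close>

definition covariant_acceleration ::
  "'a::real_normed_vector set \<Rightarrow> ('a \<Rightarrow> 'a \<Rightarrow> 'a \<Rightarrow> real) \<Rightarrow> real set \<Rightarrow> (real \<Rightarrow> 'a) \<Rightarrow> real \<Rightarrow> 'a" where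
  "covariant_acceleration T g S c t =
     velocity S (velocity S c) t + christoffel T g (c t) (velocity S c t) (velocity S c t)"

definition geodesic_on ::
  "'a::real_normed_vector set \<Rightarrow> 'a set \<Rightarrow> ('a \<Rightarrow> 'a \<Rightarrow> 'a \<Rightarrow> real) \<Rightarrow> real set \<Rightarrow> (real \<Rightarrow> 'a) \<Rightarrow> bool" where
  "geodesic_on M T g S c \<longleftrightarrow>
     (\<forall>t\<in>S. c t \<in> M) \<and> smooth_curve_on S c \<and> (\<forall>t\<in>S. covariant_acceleration T g S c t = 0)"

text \<open>
  A curve on \<open>[0,1]\<close> is an unnormalised geodesic if it is a geodesic precomposed with an
  orientation-preserving diffeomorphism of closed intervals.  Constant curves are geodesics.
\<close>

definition unnormalised_geodesic ::
  "'a::real_normed_vector set \<Rightarrow> 'a set \<Rightarrow> ('a \<Rightarrow> 'a \<Rightarrow> 'a \<Rightarrow> real) \<Rightarrow> (real \<Rightarrow> 'a) \<Rightarrow> bool" where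
  "unnormalised_geodesic M T g \<delta> \<longleftrightarrow>
     (\<exists>a b :: real. \<exists>\<phi> :: real \<Rightarrow> real. \<exists>c. a < b \<and>
        smooth_curve_on {0..1} \<phi> \<and> \<phi> 0 = a \<and> \<phi> 1 = b \<and> (\<forall>t\<in>{0..1}. 0 < velocity {0..1} \<phi> t) \<and>
        geodesic_on M T g {a..b} c \<and> (\<forall>t\<in>{0..1}. \<delta> t = c (\<phi> t)))"

definition unnormalised_geodesic_between ::
  "'a::real_normed_vector set \<Rightarrow> 'a set \<Rightarrow> ('a \<Rightarrow> 'a \<Rightarrow> 'a \<Rightarrow> real) \<Rightarrow> 'a \<Rightarrow> 'a \<Rightarrow> (real \<Rightarrow> 'a) \<Rightarrow> bool" where
  "unnormalised_geodesic_between M T g p q \<delta> \<longleftrightarrow>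
     unnormalised_geodesic M T g \<delta> \<and> \<delta> 0 = p \<and> \<delta> 1 = q"

end

theory Submission
  imports Defs
begin

text \<open>
  The map \<open>M \<mapsto> M (adj M)\<close> sends the invertible matrices of Hilbert-Schmidt norm one onto the
  density matrices, and the Bures-Wasserstein metric is the one that makes it a Riemannian submersion.
  Geodesics of the unit sphere are great circles, and a great circle whose velocity is orthogonal to
  the fibres projects to a geodesic. The velocity \<open>N\<close> at \<open>G\<close> is orthogonal to the fibre if and
  only if \<open>adj G ** N\<close> is Hermitian. The general theory of
  submersions is bypassed: the geodesic equation of the projected circle is verified directly.

  Put \<open>A = \<rho>\<^sub>1\<^sup>1\<^sup>/\<^sup>2 V\<close> and \<open>B = \<rho>\<^sub>2\<^sup>1\<^sup>/\<^sup>2 U\<close>, two unit vectors over \<open>\<rho>\<^sub>1\<close> and \<open>\<rho>\<^sub>2\<close>.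
  If \<open>W P\<close> is the polar decomposition of \<open>\<rho>\<^sub>2\<^sup>1\<^sup>/\<^sup>2 \<rho>\<^sub>1\<^sup>1\<^sup>/\<^sup>2\<close>, the hypothesis \<open>U (adj V) = W\<close> gives
  \<open>adj A ** B = adj V ** P ** V\<close>, which is positive definite. Being Hermitian, it makes the great
  circle through \<open>A\<close> and \<open>B\<close> horizontal; being positive, it makes \<open>adj A\<close> times any point of the
  segment from \<open>A\<close> to \<open>B\<close> positive definite, so that the segment consists of invertible matrices.
  Normalising the segment gives an arc of that circle (\<open>normalised_segment_geodesic\<close>), travelled
  with an arctangent reparametrisation.

  For the geodesic equation (\<open>great_circle_geodesic\<close>) the Christoffel symbols are needed. The metric
  depends on the base point through the inverse of the Lyapunov operator, which is differentiated in
  \<open>perturbed_solution_has_derivative\<close>; the Koszul formula then collapses to a closed form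
  (\<open>christoffel_bw\<close>). Square roots of positive definite matrices are obtained from a contraction
  (\<open>posdef_sqrt_exists\<close>), and both their uniqueness and the solvability of the Lyapunov equation
  come from one positivity argument (\<open>sylvester_unique\<close>).
\<close>

section \<open>Adjoints and the real inner product\<close>

lemma adj_nth: "adj A $ i $ j = cnj (A $ j $ i)"
  by (simp add: adj_def transpose_def)

lemma adj_adj [simp]: "adj (adj A) = A"
  by (simp add: vec_eq_iff adj_nth)

lemma adj_add: "adj (A + B) = adj A + adj B"
  by (simp add: vec_eq_iff adj_nth)

lemma adj_diff: "adj (A - B) = adj A - adj B"
  by (simp add: vec_eq_iff adj_nth)

lemma adj_uminus: "adj (- A) = - adj A"
  by (simp add: vec_eq_iff adj_nth)

lemma adj_scaleR: "adj (r *\<^sub>R A) = r *\<^sub>R adj A"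
  by (simp add: vec_eq_iff adj_nth)

lemma adj_0 [simp]: "adj 0 = 0"
  by (simp add: vec_eq_iff adj_nth)

lemma adj_mat_1 [simp]: "adj (mat 1) = mat 1"
  by (simp add: vec_eq_iff adj_nth mat_def)

lemma adj_mult: "adj (A ** B) = adj B ** adj A"
  by (simp add: vec_eq_iff adj_nth matrix_matrix_mult_def mult.commute)

lemmas adj_simps = adj_add adj_diff adj_uminus adj_scaleR adj_mult

lemma matrix_add_rdistrib:
  fixes A B C :: "'a::real_algebra_1^'n^'n"
  shows "(A + B) ** C = A ** C + B ** C"
  by (simp add: vec_eq_iff matrix_matrix_mult_def algebra_simps sum.distrib)

lemma matrix_mul_diff_distrib:
  fixes A B C :: "'a::real_algebra_1^'n^'n"
  shows "A ** (B - C) = A ** B - A ** C" "(A - B) ** C = A ** C - B ** C"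
  by (simp_all add: vec_eq_iff matrix_matrix_mult_def algebra_simps sum_subtractf)

lemma matrix_mul_uminus:
  fixes A B :: "'a::real_algebra_1^'n^'n"
  shows "A ** (- B) = - (A ** B)" "(- A) ** B = - (A ** B)"
  by (simp_all add: vec_eq_iff matrix_matrix_mult_def sum_negf)

lemma matrix_mul_zero:
  fixes A :: "'a::real_algebra_1^'n^'n"
  shows "A ** 0 = 0" "0 ** A = 0"
  by (simp_all add: vec_eq_iff matrix_matrix_mult_def)

lemmas matrix_ring_simps =
  matrix_add_ldistrib matrix_add_rdistrib matrix_mul_diff_distrib matrix_mul_uminus matrix_mul_zero
  matrix_scalar_ac scalar_matrix_assoc [symmetric] matrix_mul_assoc

lemma bounded_bilinear_matrix_mul:
  "bounded_bilinear ((**) :: complex^'n^'n \<Rightarrow> complex^'n^'n \<Rightarrow> complex^'n^'n)"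
proof -
  have "bilinear ((**) :: complex^'n^'n \<Rightarrow> complex^'n^'n \<Rightarrow> complex^'n^'n)"
    by (simp add: bilinear_def linear_iff matrix_ring_simps)
  then show ?thesis
    by (simp add: bilinear_conv_bounded_bilinear)
qed

text \<open>The real inner product of matrices that comes with the type is the real part of the
  Hilbert-Schmidt product, so traces of products become inner products, and the cyclicity of the
  trace becomes the rule for moving a factor to the other side.\<close>

lemma inner_matrix_sum:
  fixes A B :: "complex^'n^'n"
  shows "inner A B = (\<Sum>i\<in>UNIV. \<Sum>j\<in>UNIV. Re (A $ i $ j * cnj (B $ i $ j)))"
  by (simp add: inner_vec_def inner_complex_def)

lemma Re_trace_mult: "Re (trace (A ** B)) = inner A (adj B)"
  by (simp add: trace_def inner_matrix_sum adj_nth matrix_matrix_mult_def)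

lemma inner_adj: "inner (adj A) (adj B) = inner A B"
  unfolding inner_matrix_sum adj_nth by (subst sum.swap) simp

lemma inner_mult_left: "inner (A ** B) C = inner B (adj A ** C)"
  for A B C :: "complex^'n^'n"
proof -
  have "inner (A ** B) C = Re (trace (A ** (B ** adj C)))"
    using Re_trace_mult[of "A ** B" "adj C"] by (simp add: matrix_mul_assoc)
  also have "\<dots> = Re (trace (B ** adj (adj A ** C)))"
    by (simp add: trace_mul_sym[of A] adj_mult matrix_mul_assoc[symmetric])
  finally show ?thesis
    by (simp add: Re_trace_mult)
qed

lemma inner_mult_right: "inner (A ** B) C = inner A (C ** adj B)"
  for A B C :: "complex^'n^'n"
  using Re_trace_mult[of "A ** B" "adj C"] Re_trace_mult[of A "adj (C ** adj B)"]
  by (simp add: adj_mult matrix_mul_assoc)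

lemma hs_norm_eq_norm: "hs_norm A = norm A"
  by (simp add: hs_norm_def Re_trace_mult norm_eq_sqrt_inner)

lemma inner_matrix_vector: "inner x (A *v y) = inner (adj A *v x) (y :: complex^'n)"
proof -
  have "inner x (A *v y) = (\<Sum>i\<in>UNIV. \<Sum>j\<in>UNIV. Re (x $ i * cnj (A $ i $ j * y $ j)))"
    by (simp add: inner_vec_def inner_complex_def matrix_vector_mult_def sum_distrib_left
        sum.distrib sum_subtractf algebra_simps)
  also have "\<dots> = (\<Sum>j\<in>UNIV. \<Sum>i\<in>UNIV. Re (x $ i * cnj (A $ i $ j * y $ j)))"
    by (rule sum.swap)
  also have "\<dots> = inner (adj A *v x) y"
    by (simp add: inner_vec_def inner_complex_def matrix_vector_mult_def sum_distrib_right
        sum_distrib_left adj_nth sum.distrib algebra_simps sum_subtractf)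
  finally show ?thesis .
qed

lemma column_mult: "column j (A ** B) = A *v column j B"
  by (simp add: vec_eq_iff column_def matrix_matrix_mult_def matrix_vector_mult_def)

text \<open>This reduces the positivity of \<open>X \<mapsto> A ** X\<close> to the positivity of \<open>A\<close> on vectors.\<close>

lemma inner_columns:
  fixes A B :: "complex^'n^'n"
  shows "inner A B = (\<Sum>j\<in>UNIV. inner (column j A) (column j B))"
  unfolding inner_vec_def[where 'a="complex^'n"] inner_vec_def[where 'a=complex]
  by (subst sum.swap) (simp add: column_def)

section \<open>Positive definite matrices and the Lyapunov equation\<close>

lemma hermitian_iff: "A \<in> hermitian_matrices \<longleftrightarrow> adj A = A"
  by (simp add: hermitian_matrices_def)

lemma posdef_iff:
  "A \<in> posdef_matrices \<longleftrightarrow> adj A = A \<and> (\<forall>x. x \<noteq> 0 \<longrightarrow> 0 < inner x (A *v x))"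
proof -
  have "Re (\<Sum>i\<in>UNIV. cnj (x $ i) * (A *v x) $ i) = inner x (A *v x)" for x
    by (simp add: inner_vec_def inner_complex_def)
  then show ?thesis
    by (simp add: posdef_matrices_def hermitian_iff)
qed

lemma inner_posdef_mult_pos:
  fixes A X :: "complex^'n^'n"
  assumes "A \<in> posdef_matrices" "X \<noteq> 0"
  shows "0 < inner X (A ** X)"
proof -
  obtain j where j: "column j X \<noteq> 0"
    using assms(2) by (auto simp: vec_eq_iff column_def)
  have pos: "x \<noteq> 0 \<Longrightarrow> 0 < inner x (A *v x)" for x
    using assms(1) by (auto simp: posdef_iff)
  have "0 \<le> inner x (A *v x)" for x
    using pos[of x] by (cases "x = 0") auto
  then have "0 < (\<Sum>j\<in>UNIV. inner (column j X) (A *v column j X))"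
    using pos[OF j] by (intro sum_pos2[of UNIV j]) auto
  then show ?thesis
    by (simp add: inner_columns column_mult)
qed

lemma posdef_adj: "A \<in> posdef_matrices \<Longrightarrow> adj A = A"
  by (simp add: posdef_iff)

lemma inner_mult_posdef_pos:
  fixes A X :: "complex^'n^'n"
  assumes "A \<in> posdef_matrices" "X \<noteq> 0"
  shows "0 < inner X (X ** A)"
proof -
  have "adj X \<noteq> 0"
    using assms(2) by (metis adj_adj adj_0)
  from inner_posdef_mult_pos[OF assms(1) this] show ?thesis
    using inner_adj[of X "X ** A"] assms(1) by (simp add: adj_mult posdef_adj)
qed

text \<open>Pairing the equation with \<open>X\<close> gives a sum of two quadratic forms in \<open>X\<close>, each of
  which is positive unless \<open>X = 0\<close>. Both the invertibility of the Lyapunov operator (\<open>A = B\<close>)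
  and the uniqueness of square roots rest on this.\<close>

lemma sylvester_unique:
  fixes A B X :: "complex^'n^'n"
  assumes "A \<in> posdef_matrices" "B \<in> posdef_matrices" "A ** X + X ** B = 0"
  shows "X = 0"
proof (rule ccontr)
  assume "X \<noteq> 0"
  then have "0 < inner X (A ** X + X ** B)"
    using inner_posdef_mult_pos[OF assms(1)] inner_mult_posdef_pos[OF assms(2)]
    by (simp add: inner_add_right add_pos_pos \<open>X \<noteq> 0\<close>)
  with assms(3) show False
    by simp
qed

lemma posdef_invertible:
  assumes "A \<in> posdef_matrices"
  shows "invertible A"
proof -
  have "A *v x = 0 \<Longrightarrow> x = 0" for x
    using assms by (force simp: posdef_iff)
  then have "\<exists>B. B ** A = mat 1"
    using matrix_left_invertible_ker[of A] by blast
  then show ?thesis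
    by (simp add: invertible_left_inverse)
qed

lemma mult_adj_posdef:
  assumes "invertible A"
  shows "A ** adj A \<in> posdef_matrices"
proof -
  obtain B where B: "A ** B = mat 1"
    using assms by (auto simp: invertible_def)
  have "adj B ** adj A = mat 1"
    using arg_cong[OF B, of adj] by (simp add: adj_mult)
  then have "adj A *v x = 0 \<Longrightarrow> x = 0" for x
    by (metis matrix_left_invertible_ker)
  moreover have "inner x ((A ** adj A) *v x) = inner (adj A *v x) (adj A *v x)" for x
    by (simp add: matrix_vector_mul_assoc[symmetric] inner_matrix_vector)
  ultimately show ?thesis
    by (auto simp: posdef_iff adj_mult)
qed

lemma invertible_adj:
  assumes "invertible A"
  shows "invertible (adj A)"
proof -
  obtain B where "A ** B = mat 1" "B ** A = mat 1"
    using assms by (auto simp: invertible_def)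
  then have "adj B ** adj A = mat 1" "adj A ** adj B = mat 1"
    by (metis adj_mult adj_mat_1)+
  then show ?thesis
    by (auto simp: invertible_def)
qed

definition anticomm :: "complex^'n^'n \<Rightarrow> complex^'n^'n \<Rightarrow> complex^'n^'n" where
  "anticomm A X = A ** X + X ** A"

lemma linear_anticomm: "linear (anticomm A)"
  by (simp add: linear_iff anticomm_def matrix_ring_simps scaleR_right_distrib)

lemma inj_anticomm: "A \<in> posdef_matrices \<Longrightarrow> inj (anticomm A)"
  using linear_injective_0[OF linear_anticomm] sylvester_unique
  by (metis anticomm_def)

lemma lyapunov_eqI:
  assumes "A \<in> posdef_matrices" "anticomm A X = H"
  shows "lyapunov A H = X"
  unfolding lyapunov_def anticomm_def[symmetric]
  using assms(2) inj_anticomm[OF assms(1)] by (intro the_equality) (auto dest: injD)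

text \<open>In finite dimension the uniqueness of solutions gives their existence.\<close>

lemma anticomm_lyapunov:
  assumes "A \<in> posdef_matrices"
  shows "anticomm A (lyapunov A H) = H"
proof -
  have "surj (anticomm A)"
    using linear_injective_imp_surjective[OF linear_anticomm inj_anticomm[OF assms]] by simp
  then obtain X where "anticomm A X = H"
    by (metis surjD)
  with assms show ?thesis
    by (simp add: lyapunov_eqI)
qed

lemma adj_anticomm: "adj A = A \<Longrightarrow> adj (anticomm A X) = anticomm A (adj X)"
  by (simp add: anticomm_def adj_simps add.commute)

lemma inner_anticomm: "adj A = A \<Longrightarrow> inner (anticomm A X) Y = inner X (anticomm A Y)"
  by (simp add: anticomm_def inner_simps inner_mult_left[of A] inner_mult_right[of X])

lemma inner_lyapunov:
  assumes "A \<in> posdef_matrices"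
  shows "inner (lyapunov A H) K = inner H (lyapunov A K)"
  by (metis anticomm_lyapunov assms inner_anticomm posdef_adj)

section \<open>Square roots of positive definite matrices\<close>

text \<open>Contraction is measured in the operator norm, because the norm of the matrix type is the
  Frobenius norm, in which even the identity matrix has norm \<open>sqrt n\<close>.\<close>

definition op_bound :: "complex^'n^'n \<Rightarrow> real \<Rightarrow> bool" where
  "op_bound A r \<longleftrightarrow> (\<forall>x. norm (A *v x) \<le> r * norm x)"

lemma op_bound_add: "op_bound A r \<Longrightarrow> op_bound B s \<Longrightarrow> op_bound (A + B) (r + s)"
  unfolding op_bound_def matrix_vector_mult_add_rdistrib distrib_right
  by (auto intro: norm_triangle_mono)

lemma op_bound_mult:
  assumes "op_bound A r" "op_bound B s" "0 \<le> r"
  shows "op_bound (A ** B) (r * s)"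
  unfolding op_bound_def matrix_vector_mul_assoc[symmetric]
proof
  fix x
  have "norm (A *v (B *v x)) \<le> r * norm (B *v x)"
    using assms(1) by (simp add: op_bound_def)
  also have "\<dots> \<le> r * (s * norm x)"
    using assms(2,3) by (simp add: op_bound_def mult_left_mono)
  finally show "norm (A *v (B *v x)) \<le> r * s * norm x"
    by (simp add: mult.assoc)
qed

lemma scaleR_matrix_vector: "(r *\<^sub>R A) *v x = r *\<^sub>R (A *v (x :: complex^'n))"
  by (simp add: vec_eq_iff matrix_vector_mult_def scaleR_sum_right)

lemma op_bound_half:
  assumes "op_bound A (2 * r)"
  shows "op_bound ((1/2) *\<^sub>R A) r"
  unfolding op_bound_def
proof
  fix x
  have "norm (A *v x) \<le> 2 * r * norm x"
    using assms by (auto simp: op_bound_def)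
  then show "norm (((1/2) *\<^sub>R A) *v x) \<le> r * norm x"
    by (simp add: scaleR_matrix_vector)
qed

lemma norm_le_of_op_bound:
  fixes A :: "complex^'n^'n"
  assumes "op_bound A r" "0 \<le> r"
  shows "norm A \<le> sqrt (real CARD('n)) * r"
proof -
  have "inner (column j A) (column j A) \<le> r\<^sup>2" for j
  proof -
    have "column j A = A *v axis j 1"
      by (simp add: vec_eq_iff column_def matrix_vector_mult_def axis_def if_distrib cong: if_cong)
    moreover have "norm (A *v axis j 1) \<le> r * norm (axis j 1 :: complex^'n)"
      using assms(1) unfolding op_bound_def by blast
    moreover have "norm (axis j 1 :: complex^'n) = 1"
      by (simp add: norm_eq_sqrt_inner[of "axis j 1 :: complex^'n"] inner_axis_axis)
    ultimately have "norm (column j A) \<le> r"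
      by simp
    then show ?thesis
      unfolding power2_norm_eq_inner[symmetric] by (rule power_mono) simp
  qed
  then have "inner A A \<le> (\<Sum>j\<in>(UNIV::'n set). r\<^sup>2)"
    unfolding inner_columns by (intro sum_mono)
  then have "inner A A \<le> real CARD('n) * r\<^sup>2"
    by simp
  then have "norm A \<le> sqrt (real CARD('n) * r\<^sup>2)"
    unfolding norm_eq_sqrt_inner[of A] by (rule real_sqrt_le_mono)
  then show ?thesis
    using assms(2) by (simp add: real_sqrt_mult)
qed

lemma norm_diff_scaleR_squared:
  fixes x z :: "'a::real_inner"
  shows "(norm (x - e *\<^sub>R z))\<^sup>2 = (norm x)\<^sup>2 - 2 * e * inner x z + e\<^sup>2 * (norm z)\<^sup>2"
  unfolding power2_norm_eq_inner
  by (simp add: inner_commute[of z x] inner_diff_left inner_diff_right power2_eq_square algebra_simps)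

text \<open>By compactness of the unit sphere \<open>inner x (A x) \<ge> m |x|^2\<close> with \<open>m > 0\<close>, and
  \<open>|A x| \<le> K |x|\<close>. In \<open>|x - e A x|^2 = |x|^2 - 2 e inner x (A x) + e^2 |A x|^2\<close> the linear
  term wins for small \<open>e\<close>; the choice \<open>e = m / K^2\<close> leaves the factor \<open>1 - e m\<close>. This is
  how the need for a spectral decomposition is avoided.\<close>

lemma posdef_contraction:
  fixes A :: "complex^'n^'n"
  assumes "A \<in> posdef_matrices"
  obtains e r where "0 < e" "0 \<le> r" "r < 1" "op_bound (mat 1 - e *\<^sub>R A) r"
proof -
  have cont: "continuous_on (sphere 0 1) (\<lambda>x::complex^'n. inner x (A *v x))"
    by (intro continuous_intros linear_continuous_on) (simp add: linear_linear)
  obtain x0 :: "complex^'n" where x0: "norm x0 = 1"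
    using vector_choose_size[of 1] by auto
  then have "sphere (0::complex^'n) 1 \<noteq> {}"
    by auto
  from continuous_attains_inf[OF compact_sphere this cont]
  obtain y where y: "norm y = 1" "\<And>x. norm x = 1 \<Longrightarrow> inner y (A *v y) \<le> inner x (A *v x)"
    by auto
  define m where "m = inner y (A *v y)"
  have "y \<noteq> 0"
    using y(1) by auto
  then have m: "0 < m"
    using assms by (simp add: posdef_iff m_def)
  have lower: "m * (norm x)\<^sup>2 \<le> inner x (A *v x)" for x
  proof (cases "x = 0")
    case False
    have "A *v ((1 / norm x) *\<^sub>R x) = (1 / norm x) *\<^sub>R (A *v x)"
      using linear_scale[OF matrix_vector_mul_linear[of A]] by blast
    with y(2)[of "(1 / norm x) *\<^sub>R x"] False
    show ?thesis
      by (simp add: m_def field_simps power2_eq_square)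
  qed simp
  obtain K where K: "0 < K" "\<And>x. norm (A *v x) \<le> K * norm x"
    using linear_bounded_pos[OF matrix_vector_mul_linear[of A]] by blast
  define e where "e = m / K\<^sup>2"
  have e: "0 < e"
    using m K(1) by (simp add: e_def)
  have sq: "(norm ((mat 1 - e *\<^sub>R A) *v x))\<^sup>2 \<le> (1 - e * m) * (norm x)\<^sup>2" for x
  proof -
    have "(mat 1 - e *\<^sub>R A) *v x = x - e *\<^sub>R (A *v x)"
      by (simp only: matrix_vector_mult_diff_rdistrib scaleR_matrix_vector matrix_vector_mul_lid)
    then have "(norm ((mat 1 - e *\<^sub>R A) *v x))\<^sup>2
        = (norm x)\<^sup>2 - 2 * e * inner x (A *v x) + e\<^sup>2 * (norm (A *v x))\<^sup>2"
      by (simp only: norm_diff_scaleR_squared)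
    moreover have "2 * e * inner x (A *v x) \<ge> 2 * e * (m * (norm x)\<^sup>2)"
      using e lower by simp
    moreover have "e\<^sup>2 * (norm (A *v x))\<^sup>2 \<le> e\<^sup>2 * (K * norm x)\<^sup>2"
      using K(2) by (intro mult_left_mono power_mono) auto
    moreover have "e\<^sup>2 * (K * norm x)\<^sup>2 = e * m * (norm x)\<^sup>2"
      using K(1) by (simp add: e_def power2_eq_square)
    ultimately have "(norm ((mat 1 - e *\<^sub>R A) *v x))\<^sup>2
        \<le> (norm x)\<^sup>2 - 2 * e * (m * (norm x)\<^sup>2) + e * m * (norm x)\<^sup>2"
      by linarith
    also have "\<dots> = (1 - e * m) * (norm x)\<^sup>2"
      by (simp add: left_diff_distrib)
    finally show ?thesis .
  qed
  have em: "0 \<le> 1 - e * m"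
    using order_trans[OF zero_le_power2 sq[of x0]] x0 by simp
  show thesis
  proof (rule that)
    show "op_bound (mat 1 - e *\<^sub>R A) (sqrt (1 - e * m))"
      unfolding op_bound_def
    proof
      show "norm ((mat 1 - e *\<^sub>R A) *v x) \<le> sqrt (1 - e * m) * norm x" for x
        by (rule power2_le_imp_le) (use sq[of x] em in \<open>simp_all add: power_mult_distrib\<close>)
    qed
    show "sqrt (1 - e * m) < 1"
      using e m by (simp add: real_sqrt_lt_1_iff)
  qed (use e em in auto)
qed

lemma bounded_linear_adj: "bounded_linear (adj :: complex^'n^'n \<Rightarrow> complex^'n^'n)"
  unfolding linear_conv_bounded_linear[symmetric] by (simp add: linear_iff adj_simps)

lemma posdef_scaleR: "A \<in> posdef_matrices \<Longrightarrow> 0 < r \<Longrightarrow> r *\<^sub>R A \<in> posdef_matrices"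
  by (simp add: posdef_iff adj_scaleR scaleR_matrix_vector)

text \<open>Write \<open>B = 1 - e A\<close>, with \<open>e\<close> and \<open>r\<close> from \<open>posdef_contraction\<close>.
  A matrix \<open>Z\<close> with \<open>Z = (B + Z^2) / 2\<close> satisfies \<open>(1 - Z)^2 = e A\<close>, and
  \<open>1 - Z\<close> is positive definite when \<open>Z\<close> is Hermitian of operator norm below one. The iteration
  of \<open>Z \<mapsto> (B + Z^2) / 2\<close> from \<open>0\<close> stays in the ball of radius \<open>r < 1\<close> that contains \<open>B\<close> and
  contracts it by the factor \<open>r\<close>.\<close>

lemma posdef_sqrt_exists:
  fixes A :: "complex^'n^'n"
  assumes "A \<in> posdef_matrices"
  shows "\<exists>R. R \<in> posdef_matrices \<and> R ** R = A"
proof -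
  obtain e r where e: "0 < e" and r: "0 \<le> r" "r < 1" and bound: "op_bound (mat 1 - e *\<^sub>R A) r"
    by (rule posdef_contraction[OF assms])
  define B where "B = mat 1 - e *\<^sub>R A"
  define Y where "Y k = ((\<lambda>Z. (1/2) *\<^sub>R (B + Z ** Z)) ^^ k) 0" for k
  have Y_0: "Y 0 = 0" and Y_Suc: "Y (Suc k) = (1/2) *\<^sub>R (B + Y k ** Y k)" for k
    by (simp_all add: Y_def)
  have Y_bound: "op_bound (Y k) r" for k
  proof (induction k)
    case (Suc k)
    have "op_bound (B + Y k ** Y k) (r + r * r)"
      using bound Suc r by (intro op_bound_add op_bound_mult) (auto simp: B_def)
    moreover have "r + r * r \<le> 2 * r"
      using r by (simp add: mult_left_le)
    ultimately have "op_bound (B + Y k ** Y k) (2 * r)"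
      unfolding op_bound_def by (meson mult_right_mono norm_ge_zero order_trans)
    then show ?case
      unfolding Y_Suc by (rule op_bound_half)
  qed (use r in \<open>simp add: Y_0 op_bound_def\<close>)
  have step_bound: "op_bound (Y (Suc k) - Y k) (r ^ Suc k)" for k
  proof (induction k)
    case 0
    show ?case
      using Y_bound[of 1] by (simp add: Y_0)
  next
    case (Suc k)
    have "Y (Suc (Suc k)) - Y (Suc k)
        = (1/2) *\<^sub>R (Y (Suc k) ** Y (Suc k) - Y k ** Y k)"
      unfolding Y_Suc[of "Suc k"] by (subst (3) Y_Suc) (simp add: scaleR_right_distrib scaleR_right_diff_distrib)
    also have "Y (Suc k) ** Y (Suc k) - Y k ** Y k
        = Y (Suc k) ** (Y (Suc k) - Y k) + (Y (Suc k) - Y k) ** Y k"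
      by (simp add: matrix_ring_simps)
    finally have eq: "Y (Suc (Suc k)) - Y (Suc k)
        = (1/2) *\<^sub>R (Y (Suc k) ** (Y (Suc k) - Y k) + (Y (Suc k) - Y k) ** Y k)" .
    have "op_bound (Y (Suc k) ** (Y (Suc k) - Y k) + (Y (Suc k) - Y k) ** Y k)
        (r * r ^ Suc k + r ^ Suc k * r)"
      using Y_bound Suc r by (intro op_bound_add op_bound_mult) auto
    then show ?case
      unfolding eq by (intro op_bound_half) (simp add: algebra_simps)
  qed
  have "summable (\<lambda>k. Y (Suc k) - Y k)"
  proof (rule summable_comparison_test')
    show "summable (\<lambda>k. sqrt (real CARD('n)) * r ^ Suc k)"
      using r by (intro summable_mult summable_ignore_initial_segment[where k=1, simplified])
        (simp add: summable_geometric)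
    show "norm (Y (Suc k) - Y k) \<le> sqrt (real CARD('n)) * r ^ Suc k" for k
      using r by (intro norm_le_of_op_bound step_bound) auto
  qed
  then have "(\<lambda>n. \<Sum>k<n. Y (Suc k) - Y k) \<longlonglongrightarrow> (\<Sum>k. Y (Suc k) - Y k)"
    by (rule summable_LIMSEQ)
  then obtain Z where Z: "Y \<longlonglongrightarrow> Z"
    by (auto simp: sum_lessThan_telescope Y_0)
  have "(\<lambda>k. Y (Suc k)) \<longlonglongrightarrow> (1/2) *\<^sub>R (B + Z ** Z)"
    unfolding Y_Suc
    by (intro tendsto_intros bounded_bilinear.tendsto[OF bounded_bilinear_matrix_mul] Z)
  then have fixpoint: "Z = (1/2) *\<^sub>R (B + Z ** Z)"
    by (rule LIMSEQ_unique[OF LIMSEQ_Suc[OF Z]])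
  have "adj (Y k) = Y k" for k
    using posdef_adj[OF assms] by (induction k) (simp_all add: Y_0 Y_Suc B_def adj_simps)
  moreover have "(\<lambda>k. adj (Y k)) \<longlonglongrightarrow> adj Z"
    by (rule bounded_linear.tendsto[OF bounded_linear_adj Z])
  ultimately have "Y \<longlonglongrightarrow> adj Z"
    by simp
  then have adj_Z: "adj Z = Z"
    by (rule LIMSEQ_unique[OF _ Z])
  have "norm (Z *v x) \<le> r * norm x" for x
  proof (rule LIMSEQ_le_const2)
    have "linear (\<lambda>M. M *v x)"
      by (simp add: linear_iff matrix_vector_mult_add_rdistrib scaleR_matrix_vector)
    then have "bounded_linear (\<lambda>M. M *v x)"
      by (simp add: linear_conv_bounded_linear)
    then show "(\<lambda>k. norm (Y k *v x)) \<longlonglongrightarrow> norm (Z *v x)"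
      by (intro tendsto_norm bounded_linear.tendsto[OF _ Z])
    show "\<exists>N. \<forall>n\<ge>N. norm (Y n *v x) \<le> r * norm x"
      using Y_bound by (simp add: op_bound_def)
  qed
  then have "inner x (Z *v x) \<le> norm x * (r * norm x)" for x
    by (meson mult_left_mono norm_cauchy_schwarz norm_ge_zero order_trans)
  moreover have "norm x * (r * norm x) < norm x * norm x" if "x \<noteq> 0" for x :: "complex^'n"
    using that r by simp
  ultimately have "inner x (Z *v x) < inner x x" if "x \<noteq> 0" for x :: "complex^'n"
    using that by (metis order_le_less_trans dot_square_norm power2_eq_square)
  then have R_posdef: "mat 1 - Z \<in> posdef_matrices"
    by (simp add: posdef_iff adj_simps adj_Z matrix_vector_mult_diff_rdistrib inner_diff_right)
  have "2 *\<^sub>R Z = 2 *\<^sub>R ((1/2) *\<^sub>R (B + Z ** Z))"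
    using fixpoint by (rule arg_cong)
  then have "Z + Z = B + Z ** Z"
    by (simp add: scaleR_2)
  then have R_sq: "(mat 1 - Z) ** (mat 1 - Z) = e *\<^sub>R A"
    by (simp add: matrix_ring_simps B_def algebra_simps)
  have "(1 / sqrt e) * (1 / sqrt e) * e = 1"
    using e by simp
  then have "((1 / sqrt e) *\<^sub>R (mat 1 - Z)) ** ((1 / sqrt e) *\<^sub>R (mat 1 - Z)) = A"
    by (simp add: matrix_scalar_ac scalar_matrix_assoc[symmetric] R_sq)
  moreover have "(1 / sqrt e) *\<^sub>R (mat 1 - Z) \<in> posdef_matrices"
    using R_posdef e by (intro posdef_scaleR) auto
  ultimately show ?thesis
    by blast
qed

text \<open>The difference of two square roots solves a homogeneous Sylvester equation.\<close>

lemma posdef_sqrt_unique: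
  assumes "R \<in> posdef_matrices" "S \<in> posdef_matrices" "R ** R = S ** S"
  shows "R = S"
proof -
  have "R ** (R - S) + (R - S) ** S = 0"
    using assms(3) by (simp add: matrix_ring_simps)
  then have "R - S = 0"
    by (rule sylvester_unique[OF assms(1,2)])
  then show ?thesis
    by simp
qed

lemma posdef_sqrt:
  assumes "A \<in> posdef_matrices"
  shows "posdef_sqrt A \<in> posdef_matrices" "posdef_sqrt A ** posdef_sqrt A = A"
proof -
  have "\<exists>!R. R \<in> posdef_matrices \<and> R ** R = A"
    using posdef_sqrt_exists[OF assms] posdef_sqrt_unique by blast
  from theI'[OF this] show "posdef_sqrt A \<in> posdef_matrices" "posdef_sqrt A ** posdef_sqrt A = A"
    by (auto simp: posdef_sqrt_def)
qed

lemma matrix_inv_cancel: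
  assumes "invertible A"
  shows "matrix_inv A ** A = mat 1" "A ** matrix_inv A = mat 1"
  using someI_ex[OF assms[unfolded invertible_def]] by (auto simp: matrix_inv_def)

lemma polar_decomposition:
  assumes "invertible M"
  obtains P where "P \<in> posdef_matrices" "M = polar_factor M ** P"
proof
  have "adj M ** M \<in> posdef_matrices"
    using mult_adj_posdef[OF invertible_adj[OF assms]] by simp
  then show "posdef_sqrt (adj M ** M) \<in> posdef_matrices"
    by (rule posdef_sqrt)
  from matrix_inv_cancel(1)[OF posdef_invertible[OF this]]
  show "M = polar_factor M ** posdef_sqrt (adj M ** M)"
    by (simp add: polar_factor_def matrix_mul_assoc[symmetric])
qed

section \<open>The Levi-Civita connection of the Bures-Wasserstein metric\<close>

text \<open>Differentiating \<open>(F + s E) (X s) = v\<close> at \<open>s = 0\<close> formally gives \<open>F (X' 0) = - E (X 0)\<close>. To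
  justify it, note that \<open>F + s E\<close> is bounded below by \<open>b / 2\<close> for small \<open>s\<close>, where \<open>b\<close> is a lower
  bound of \<open>F\<close>, and maps the error \<open>X s - x - s y\<close> to \<open>- s^2 E y\<close>; hence the error is quadratic
  in \<open>s\<close>. The solution is written as a definite description so that the lemma applies verbatim to
  the Lyapunov operator at a moving base point.\<close>

lemma perturbed_solution_has_derivative:
  fixes F E :: "'a::euclidean_space \<Rightarrow> 'a"
  assumes "linear F" "linear E" "inj F" "F x = v" "F y = - E x"
  shows "((\<lambda>s. THE z. F z + s *\<^sub>R E z = v) has_vector_derivative y) (at 0)"
proof -
  define X where "X s = (THE z. F z + s *\<^sub>R E z = v)" for s
  obtain b where b: "0 < b" "\<And>z. b * norm z \<le> norm (F z)"
    using linear_inj_bounded_below_pos[OF assms(1,3)] by metis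
  obtain c where c: "0 < c" "\<And>z. norm (E z) \<le> c * norm z"
    using linear_bounded_pos[OF assms(2)] by blast
  have near: "norm (X s - x - s *\<^sub>R y) \<le> (2 / b * norm (E y)) * s\<^sup>2" if s: "\<bar>s\<bar> < b / (2 * c)" for s
  proof -
    define G where "G z = F z + s *\<^sub>R E z" for z
    have lin: "linear G"
      using assms(1,2) by (auto simp: linear_iff G_def scaleR_right_distrib)
    have below: "b / 2 * norm z \<le> norm (G z)" for z
    proof -
      have "norm (s *\<^sub>R E z) \<le> \<bar>s\<bar> * (c * norm z)"
        using c by (simp add: mult_left_mono)
      also have "\<dots> \<le> b / (2 * c) * (c * norm z)"
        using s c by (intro mult_right_mono) auto
      also have "\<dots> = b / 2 * norm z"
        using c by simp
      finally show ?thesis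
        using b(2)[of z] norm_diff_ineq[of "F z" "s *\<^sub>R E z"] by (simp add: G_def)
    qed
    have inj: "inj G"
      unfolding linear_injective_0[OF lin]
    proof (intro allI impI)
      fix z assume "G z = 0"
      then show "z = 0"
        using below[of z] b(1) by (simp add: mult_le_0_iff)
    qed
    then have "surj G"
      using linear_injective_imp_surjective[OF lin] by simp
    then obtain z where z: "G z = v"
      by (metis surjD)
    then have "X s = z"
      unfolding X_def G_def[symmetric] using inj by (intro the_equality) (auto dest: injD)
    with z have "G (X s) = v"
      by simp
    moreover have "G (x + s *\<^sub>R y) = v + s\<^sup>2 *\<^sub>R E y"
      using assms(4,5) by (simp add: G_def linear_add[OF assms(1)] linear_add[OF assms(2)]
          linear_scale[OF assms(1)] linear_scale[OF assms(2)] scaleR_right_distrib power2_eq_square)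
    ultimately have "G (X s - x - s *\<^sub>R y) = - (s\<^sup>2 *\<^sub>R E y)"
      using linear_diff[OF lin, of "X s" "x + s *\<^sub>R y"] by (simp add: algebra_simps)
    then show ?thesis
      using below[of "X s - x - s *\<^sub>R y"] b(1) by (simp add: field_simps)
  qed
  have "0 < b / (2 * c)"
    using b c by simp
  with near[of 0] have X_0: "X 0 = x"
    by simp
  have "((\<lambda>s. norm (X s - X 0 - (s - 0) *\<^sub>R y) / norm (s - 0)) \<longlongrightarrow> 0) (at 0)"
  proof (rule Lim_null_comparison)
    have "\<forall>\<^sub>F s in at 0. \<bar>s\<bar> < b / (2 * c)"
      using \<open>0 < b / (2 * c)\<close> by (auto simp: eventually_at dist_real_def)
    then show "\<forall>\<^sub>F s in at 0. norm (norm (X s - X 0 - (s - 0) *\<^sub>R y) / norm (s - 0))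
        \<le> (2 / b * norm (E y)) * \<bar>s\<bar>"
    proof (rule eventually_mono)
      fix s assume "\<bar>s\<bar> < b / (2 * c)"
      from near[OF this]
      show "norm (norm (X s - X 0 - (s - 0) *\<^sub>R y) / norm (s - 0)) \<le> (2 / b * norm (E y)) * \<bar>s\<bar>"
        by (cases "s = 0") (simp_all add: X_0 pos_divide_le_eq power2_eq_square mult.assoc
            del: times_divide_eq_left)
    qed
    have "((\<lambda>s. (2 / b * norm (E y)) * \<bar>s\<bar>) \<longlongrightarrow> (2 / b * norm (E y)) * \<bar>0\<bar>) (at (0::real))"
      by (intro tendsto_intros)
    then show "((\<lambda>s. (2 / b * norm (E y)) * \<bar>s\<bar>) \<longlongrightarrow> 0) (at (0::real))"
      by simp
  qed
  then have "(X has_vector_derivative y) (at 0)"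
    by (simp add: has_vector_derivative_def has_derivative_iff_norm bounded_linear_scaleR_left)
  then show ?thesis
    unfolding X_def .
qed

lemma bw_metric_eq_inner: "bw_metric p v w = inner (lyapunov p v) (adj w) / 2"
  by (simp add: bw_metric_def Re_trace_mult)

lemma dir_deriv_bw_metric:
  assumes "p \<in> posdef_matrices"
  shows "dir_deriv (\<lambda>q. bw_metric q v w) p u
    = - inner (lyapunov p (anticomm u (lyapunov p v))) (adj w) / 2"
proof -
  let ?y = "- lyapunov p (anticomm u (lyapunov p v))"
  have "((\<lambda>s. THE z. anticomm p z + s *\<^sub>R anticomm u z = v) has_vector_derivative ?y) (at 0)"
    using assms by (intro perturbed_solution_has_derivative[where x = "lyapunov p v"])
      (simp_all add: linear_anticomm inj_anticomm anticomm_lyapunov linear_neg[OF linear_anticomm])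
  moreover have "(\<lambda>s. THE z. anticomm p z + s *\<^sub>R anticomm u z = v) = (\<lambda>s. lyapunov (p + s *\<^sub>R u) v)"
    by (simp add: lyapunov_def anticomm_def matrix_ring_simps scaleR_right_distrib algebra_simps)
  ultimately have "((\<lambda>s. lyapunov (p + s *\<^sub>R u) v) has_vector_derivative ?y) (at 0)"
    by simp
  from bounded_linear.has_vector_derivative[OF bounded_linear_inner_left[of "adj w"] this]
  have "((\<lambda>s. inner (lyapunov (p + s *\<^sub>R u) v) (adj w)) has_real_derivative inner ?y (adj w)) (at 0)"
    by (simp add: has_real_derivative_iff_has_vector_derivative)
  then have "((\<lambda>s. bw_metric (p + s *\<^sub>R u) v w) has_real_derivative inner ?y (adj w) / 2) (at 0)"
    unfolding bw_metric_eq_inner by (intro DERIV_cdivide)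
  then show ?thesis
    unfolding dir_deriv_def by (simp add: DERIV_imp_deriv)
qed

lemma trace_adj: "trace (adj A) = cnj (trace A)"
  by (simp add: trace_def adj_nth)

lemma trace_scaleR: "trace (r *\<^sub>R A) = r *\<^sub>R trace (A :: complex^'n^'n)"
  by (simp add: trace_def scaleR_sum_right)

lemma trace_hermitian:
  assumes "adj A = A"
  shows "trace A = complex_of_real (Re (trace A))"
  using trace_adj[of A] assms by (simp add: complex_eq_iff)

text \<open>Let \<open>Z\<close> be the Lyapunov solution for \<open>L p L\<close>. The two kinds of derivative of the metric in the
  Koszul formula contribute \<open>- inner (L^2 + 2 Z) w / 2\<close> and \<open>inner (L^2) w / 2\<close>; the terms in \<open>L^2\<close>
  cancel and \<open>- inner Z w\<close> remains, which is the metric paired with \<open>- 2 L p L\<close>. On all positive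
  definite matrices this would be the answer. The multiple of \<open>p\<close> makes it traceless without
  changing any pairing with a traceless \<open>w\<close>, because the Lyapunov solution for \<open>2 p\<close> is the
  identity matrix.\<close>

lemma christoffel_bw:
  fixes p L u :: "complex^'n^'n"
  assumes "p \<in> density_matrices" "adj L = L" "anticomm p L = u" "trace u = 0"
  shows "christoffel traceless_hermitian bw_metric p u u
    = (2 * Re (trace (L ** p ** L))) *\<^sub>R p - 2 *\<^sub>R (L ** p ** L)" (is "_ = ?x")
proof -
  let ?\<tau> = "Re (trace (L ** p ** L))"
  have p: "p \<in> posdef_matrices" "adj p = p" and tr: "trace p = 1"
    using assms(1) by (auto simp: density_matrices_def posdef_adj)
  have lyap_u: "lyapunov p u = L"
    using lyapunov_eqI[OF p(1) assms(3)] .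
  define Z where "Z = lyapunov p (L ** p ** L)"
  have Z: "anticomm p Z = L ** p ** L"
    by (simp add: Z_def anticomm_lyapunov p)
  have "anticomm p (L ** L + 2 *\<^sub>R Z) = anticomm u L"
    unfolding linear_add[OF linear_anticomm] linear_scale[OF linear_anticomm] Z assms(3)[symmetric]
    by (simp add: anticomm_def matrix_ring_simps scaleR_2)
  then have second: "lyapunov p (anticomm u L) = L ** L + 2 *\<^sub>R Z"
    by (rule lyapunov_eqI[OF p(1)])
  have "anticomm p (?\<tau> *\<^sub>R mat 1 - 2 *\<^sub>R Z) = ?x"
    unfolding linear_diff[OF linear_anticomm] linear_scale[OF linear_anticomm] Z
    by (simp add: anticomm_def matrix_ring_simps scaleR_2[symmetric])
  then have lyap_x: "lyapunov p ?x = ?\<tau> *\<^sub>R mat 1 - 2 *\<^sub>R Z"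
    by (rule lyapunov_eqI[OF p(1)])
  have first: "christoffel_first bw_metric p u u w = - inner Z w" if "adj w = w" for w
  proof -
    have "inner (lyapunov p (anticomm w L)) (adj u) = inner (anticomm w L) L"
      using assms(2) p lyap_u adj_anticomm[OF p(2), of L] assms(3) by (simp add: inner_lyapunov)
    also have "\<dots> = 2 * inner (L ** L) w"
      by (simp add: anticomm_def inner_add_left inner_mult_left[of L w] inner_mult_right[of w L]
          assms(2) inner_commute[of "L ** L" w])
    finally show ?thesis
      using that by (simp add: christoffel_first_def dir_deriv_bw_metric p lyap_u second inner_add_left)
  qed
  show ?thesis
    unfolding christoffel_def
  proof (rule the_equality)
    have "adj (L ** p ** L) = L ** p ** L"
      by (simp add: adj_mult assms p matrix_mul_assoc)
    then show x: "?x \<in> traceless_hermitian \<and> (\<forall>w\<in>traceless_hermitian.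
        bw_metric p ?x w = christoffel_first bw_metric p u u w)"
    proof (intro conjI ballI)
      assume herm: "adj (L ** p ** L) = L ** p ** L"
      show "?x \<in> traceless_hermitian"
        using trace_hermitian[OF herm]
        by (simp add: traceless_hermitian_def hermitian_iff adj_diff adj_scaleR herm p trace_sub
            trace_scaleR tr scaleR_conv_of_real[where 'a = complex])
      fix w :: "complex^'n^'n" assume "w \<in> traceless_hermitian"
      then have w: "adj w = w" "trace w = 0"
        by (auto simp: traceless_hermitian_def hermitian_iff)
      then have "inner (mat 1) w = 0"
        using Re_trace_mult[of "mat 1" w] by simp
      then show "bw_metric p ?x w = christoffel_first bw_metric p u u w"
        by (simp add: bw_metric_eq_inner lyap_x first w inner_diff_left)
    qed
    \<comment> \<open>Uniqueness: the metric is nondegenerate on traceless matrices, as its value at \<open>y - ?x\<close>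
      is a positive form in the Lyapunov solution \<open>K\<close>.\<close>
    fix y assume y: "y \<in> traceless_hermitian \<and> (\<forall>w\<in>traceless_hermitian.
        bw_metric p y w = christoffel_first bw_metric p u u w)"
    have d: "y - ?x \<in> traceless_hermitian"
      using x y by (auto simp: traceless_hermitian_def hermitian_iff adj_diff trace_sub)
    define K where "K = lyapunov p y - lyapunov p ?x"
    have K: "anticomm p K = y - ?x"
      by (simp add: K_def linear_diff[OF linear_anticomm] anticomm_lyapunov p)
    have "bw_metric p y (y - ?x) = bw_metric p ?x (y - ?x)"
      using x y d by metis
    then have "inner K (anticomm p K) = 0"
      using d unfolding K
      by (simp add: bw_metric_eq_inner traceless_hermitian_def hermitian_iff K_def inner_diff_left)
    then have "K = 0"
      using inner_posdef_mult_pos[OF p(1), of K] inner_mult_posdef_pos[OF p(1), of K]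
      by (fastforce simp: anticomm_def inner_add_right)
    then show "y = ?x"
      using K by (simp add: anticomm_def matrix_mul_zero)
  qed
qed

section \<open>Great circles of horizontal matrices\<close>

text \<open>For orthonormal \<open>P\<close> and \<open>Q\<close> this is a unit-speed geodesic of the Hilbert-Schmidt unit sphere.\<close>

definition great_circle :: "complex^'n^'n \<Rightarrow> complex^'n^'n \<Rightarrow> real \<Rightarrow> complex^'n^'n" where
  "great_circle P Q s = cos s *\<^sub>R P + sin s *\<^sub>R Q"

lemma trace_mult_adj: "trace (A ** adj A) = complex_of_real (inner A A)"
  using trace_hermitian[of "A ** adj A"] by (simp add: adj_mult Re_trace_mult)

lemma has_vector_derivative_scaleR_const:
  "(f has_real_derivative f') (at s within S) \<Longrightarrow>
    ((\<lambda>s. f s *\<^sub>R v) has_vector_derivative f' *\<^sub>R v) (at s within S)"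
  using has_vector_derivative_scaleR[OF _ has_vector_derivative_const] by fastforce

lemma velocityI:
  fixes c :: "real \<Rightarrow> 'a::euclidean_space"
  assumes "a < b" "t \<in> {a..b}" "(c has_vector_derivative v) (at t within {a..b})"
  shows "velocity {a..b} c t = v"
  unfolding velocity_def using assms by (rule vector_derivative_within_closed_interval)

text \<open>The derivatives in a witness of smoothness are the iterated velocities; on a nondegenerate closed
  interval one-sided derivatives at the end points are unique as well.\<close>

lemma smooth_curve_velocities:
  fixes D :: "nat \<Rightarrow> real \<Rightarrow> 'a::euclidean_space"
  assumes "a < b" "t \<in> {a..b}" "\<And>t. t \<in> {a..b} \<Longrightarrow> D 0 t = c t"
    and deriv: "\<And>k t. t \<in> {a..b} \<Longrightarrow> (D k has_vector_derivative D (Suc k) t) (at t within {a..b})"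
  shows "velocity {a..b} c t = D 1 t" "velocity {a..b} (velocity {a..b} c) t = D 2 t"
proof -
  have vel: "velocity {a..b} c s = D 1 s" if "s \<in> {a..b}" for s
  proof (rule velocityI[OF \<open>a < b\<close> that])
    show "(c has_vector_derivative D 1 s) (at s within {a..b})"
      by (rule has_vector_derivative_transform[OF that, of c "D 0"])
        (use assms(3) deriv[OF that, of 0] in simp_all)
  qed
  then show "velocity {a..b} c t = D 1 t"
    using assms(2) .
  show "velocity {a..b} (velocity {a..b} c) t = D 2 t"
  proof (rule velocityI[OF \<open>a < b\<close> assms(2)])
    show "(velocity {a..b} c has_vector_derivative D 2 t) (at t within {a..b})"
      by (rule has_vector_derivative_transform[OF assms(2), of _ "D 1"])
        (use vel deriv[OF assms(2), of 1] in \<open>simp_all add: numeral_2_eq_2\<close>)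
  qed
qed

text \<open>Let \<open>G\<close> be the great circle and \<open>N\<close> its derivative, so that \<open>N' = - G\<close>. The symmetry of
  \<open>adj P ** Q\<close> makes \<open>adj G ** N\<close> Hermitian along the whole circle, that is, \<open>N = L G\<close> with
  \<open>L\<close> Hermitian: the circle is horizontal for the projection \<open>G \<mapsto> G (adj G)\<close>. For the projected
  curve \<open>c\<close> this gives \<open>c' = L c + c L\<close> and \<open>L c L = N (adj N)\<close>, which has trace one, whereas
  differentiating twice gives \<open>c'' = 2 N (adj N) - 2 c\<close>. The Christoffel term is exactly
  \<open>2 c - 2 L c L\<close>, so the covariant acceleration vanishes.\<close>

lemma great_circle_geodesic:
  fixes P Q :: "complex^'n^'n"
  assumes "a < b" and norms: "inner P P = 1" "inner Q Q = 1" "inner P Q = 0"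
    and herm: "adj P ** Q = adj Q ** P"
    and inv: "\<And>s. s \<in> {a..b} \<Longrightarrow> invertible (great_circle P Q s)"
  shows "geodesic_on density_matrices traceless_hermitian bw_metric {a..b}
    (\<lambda>s. great_circle P Q s ** adj (great_circle P Q s))" (is "geodesic_on _ _ _ _ ?c")
proof -
  \<comment> \<open>Double angles turn the projected circle into a constant plus one sinusoid, whose derivatives
    of every order are explicit.\<close>
  define D where "D k s = (if k = 0 then (1/2) *\<^sub>R (P ** adj P + Q ** adj Q) else 0)
      + (2 ^ k * cos (2 * s + real k * (pi / 2))) *\<^sub>R ((1/2) *\<^sub>R (P ** adj P - Q ** adj Q))
      + (2 ^ k * sin (2 * s + real k * (pi / 2))) *\<^sub>R ((1/2) *\<^sub>R (P ** adj Q + Q ** adj P))"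
    for k s
  define N where "N s = cos s *\<^sub>R Q - sin s *\<^sub>R P" for s
  have D_0: "?c s = D 0 s" for s
  proof -
    have "?c s = (cos s)\<^sup>2 *\<^sub>R (P ** adj P) + (sin s)\<^sup>2 *\<^sub>R (Q ** adj Q)
        + (sin s * cos s) *\<^sub>R (P ** adj Q + Q ** adj P)"
      by (simp add: great_circle_def adj_simps matrix_ring_simps scaleR_right_distrib
          power2_eq_square mult.commute)
    moreover have "(cos s)\<^sup>2 = (1 + cos (2 * s)) / 2" "(sin s)\<^sup>2 = (1 - cos (2 * s)) / 2"
      "sin s * cos s = sin (2 * s) / 2"
      using sin_squared_eq[of s] by (simp_all add: cos_double_cos sin_double)
    ultimately have "?c s = ((1 + cos (2 * s)) / 2) *\<^sub>R (P ** adj P)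
        + ((1 - cos (2 * s)) / 2) *\<^sub>R (Q ** adj Q) + (sin (2 * s) / 2) *\<^sub>R (P ** adj Q + Q ** adj P)"
      by simp
    then show ?thesis
      by (simp add: D_def algebra_simps add_divide_distrib diff_divide_distrib)
  qed
  have deriv: "(D k has_vector_derivative D (Suc k) s) (at s within S)" for k s S
  proof -
    have *: "2 * s + real (Suc k) * (pi / 2) = (2 * s + real k * (pi / 2)) + pi / 2"
      by (simp add: algebra_simps)
    have "cos (2 * s + real (Suc k) * (pi / 2)) = - sin (2 * s + real k * (pi / 2))"
      "sin (2 * s + real (Suc k) * (pi / 2)) = cos (2 * s + real k * (pi / 2))"
      unfolding * cos_add[of _ "pi / 2"] sin_add[of _ "pi / 2"] by simp_all
    then have cos': "((\<lambda>s. 2 ^ k * cos (2 * s + real k * (pi / 2)))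
        has_real_derivative 2 ^ Suc k * cos (2 * s + real (Suc k) * (pi / 2))) (at s within S)"
      and sin': "((\<lambda>s. 2 ^ k * sin (2 * s + real k * (pi / 2)))
        has_real_derivative 2 ^ Suc k * sin (2 * s + real (Suc k) * (pi / 2))) (at s within S)"
      by (auto intro!: derivative_eq_intros)
    show ?thesis
      unfolding D_def[abs_def] nat.distinct if_False
      by (intro has_vector_derivative_add has_vector_derivative_const
          has_vector_derivative_scaleR_const cos' sin')
        simp
  qed
  have G': "(great_circle P Q has_vector_derivative N s) (at s)" for s
    using has_vector_derivative_add[OF
        has_vector_derivative_scaleR_const[OF DERIV_cos[of s], of P]
        has_vector_derivative_scaleR_const[OF DERIV_sin[of s], of Q]]
    by (simp add: great_circle_def[abs_def] N_def)
  have N': "(N has_vector_derivative - great_circle P Q s) (at s)" for s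
  proof -
    have "- great_circle P Q s = (- sin s) *\<^sub>R Q - cos s *\<^sub>R P"
      by (simp add: great_circle_def)
    then show ?thesis
      unfolding N_def[abs_def]
      using has_vector_derivative_diff[OF
          has_vector_derivative_scaleR_const[OF DERIV_cos[of s], of Q]
          has_vector_derivative_scaleR_const[OF DERIV_sin[of s], of P]]
      by (simp only:)
  qed
  note adj' = bounded_linear.has_vector_derivative[OF bounded_linear_adj]
  note mult' = bounded_bilinear.has_vector_derivative[OF bounded_bilinear_matrix_mul]
  have "(D 0 has_vector_derivative
      great_circle P Q s ** adj (N s) + N s ** adj (great_circle P Q s)) (at s)" for s
    unfolding D_0[symmetric, abs_def] by (rule mult'[OF G' adj'[OF G']])
  from vector_derivative_unique_at[OF deriv this]
  have D_1: "D 1 s = great_circle P Q s ** adj (N s) + N s ** adj (great_circle P Q s)" for s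
    by simp
  have "(D 1 has_vector_derivative
      great_circle P Q s ** adj (- great_circle P Q s) + N s ** adj (N s)
      + (N s ** adj (N s) + - great_circle P Q s ** adj (great_circle P Q s))) (at s)" for s
    unfolding D_1[abs_def]
    by (rule has_vector_derivative_add[OF mult'[OF G' adj'[OF N']] mult'[OF N' adj'[OF G']]])
  from vector_derivative_unique_at[OF deriv this]
  have D_2: "D 2 s = 2 *\<^sub>R (N s ** adj (N s)) - 2 *\<^sub>R ?c s" for s
    by (simp add: numeral_2_eq_2 scaleR_2 adj_uminus matrix_mul_uminus)
  have smooth: "smooth_curve_on {a..b} ?c"
    unfolding smooth_curve_on_def using D_0 deriv by metis
  have density: "?c s \<in> density_matrices"
    and geodesic: "D 2 s + christoffel traceless_hermitian bw_metric (?c s) (D 1 s) (D 1 s) = 0"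
    if "s \<in> {a..b}" for s
  proof -
    let ?G = "great_circle P Q s"
    have sc: "sin s * sin s + cos s * cos s = 1"
      using sin_cos_squared_add3[of s] by (simp add: add.commute)
    have GG: "inner ?G ?G = 1" and NN: "inner (N s) (N s) = 1" and NG: "inner (N s) ?G = 0"
      using norms sc by (simp_all add: great_circle_def N_def inner_add_left inner_add_right
          inner_diff_left inner_diff_right inner_commute[of Q P] add.commute mult.commute)
    show dens: "?c s \<in> density_matrices"
      using mult_adj_posdef[OF inv[OF that]] by (simp add: density_matrices_def trace_mult_adj GG)
    define I where "I = matrix_inv ?G"
    have I: "I ** ?G = mat 1" "?G ** I = mat 1"
      using matrix_inv_cancel[OF inv[OF that]] by (auto simp: I_def)
    have I_adj: "adj I ** adj ?G = mat 1"
      using arg_cong[OF I(2), of adj] by (simp add: adj_mult)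
    define L where "L = N s ** I"
    have LG: "L ** ?G = N s"
      by (simp add: L_def matrix_mul_assoc[symmetric] I)
    have "adj ?G ** N s = adj (N s) ** ?G"
      by (simp add: great_circle_def N_def adj_simps matrix_ring_simps herm algebra_simps)
    then have "adj I ** (adj (N s) ** ?G) ** I = adj I ** (adj ?G ** N s) ** I"
      by simp
    then have "adj I ** adj (N s) ** (?G ** I) = (adj I ** adj ?G) ** (N s ** I)"
      by (simp only: matrix_mul_assoc)
    then have adj_L: "adj L = L"
      by (simp add: I I_adj L_def adj_mult)
    have GL: "adj ?G ** L = adj (N s)"
      using arg_cong[OF LG, of adj] by (simp add: adj_mult adj_L)
    have "anticomm (?c s) L = D 1 s"
      unfolding D_1 anticomm_def
      by (simp add: matrix_mul_assoc LG add.commute) (simp add: matrix_mul_assoc[symmetric] GL)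
    moreover have LcL: "L ** ?c s ** L = N s ** adj (N s)"
      by (simp add: matrix_mul_assoc LG) (simp add: matrix_mul_assoc[symmetric] GL)
    moreover have "trace (D 1 s) = 0"
    proof -
      have "adj (D 1 s) = D 1 s"
        unfolding D_1 by (simp add: adj_simps add.commute)
      moreover have "Re (trace (D 1 s)) = 0"
        unfolding D_1 by (simp add: trace_add Re_trace_mult NG inner_commute[of ?G])
      ultimately show ?thesis
        using trace_hermitian by fastforce
    qed
    ultimately show "D 2 s + christoffel traceless_hermitian bw_metric (?c s) (D 1 s) (D 1 s) = 0"
      using christoffel_bw[OF dens adj_L] by (simp add: Re_trace_mult NN D_2)
  qed
  show ?thesis
    unfolding geodesic_on_def covariant_acceleration_def
    using density smooth geodesic smooth_curve_velocities[OF \<open>a < b\<close> _ D_0[symmetric] deriv]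
    by simp
qed

lemma constant_geodesic:
  assumes "p \<in> density_matrices" "a < b"
  shows "geodesic_on density_matrices traceless_hermitian bw_metric {a..b} (\<lambda>s. p)"
proof -
  define D where "D k s = (if k = 0 then p else 0)" for k :: nat and s :: real
  have deriv: "(D k has_vector_derivative D (Suc k) s) (at s within S)" for k s S
    by (cases k) (simp_all add: D_def[abs_def])
  have D_0: "p = D 0 s" for s
    by (simp add: D_def)
  have "smooth_curve_on {a..b} (\<lambda>s. p)"
    unfolding smooth_curve_on_def using D_0 deriv by metis
  moreover have "christoffel traceless_hermitian bw_metric p 0 0 = 0"
    using christoffel_bw[OF assms(1), of 0 0] by (simp add: anticomm_def matrix_mul_zero trace_def)
  ultimately show ?thesis
    unfolding geodesic_on_def covariant_acceleration_def
    using assms(1) smooth_curve_velocities[OF \<open>a < b\<close> _ D_0[symmetric] deriv]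
    by (simp add: D_def)
qed

text \<open>With \<open>y = arctan x\<close>, the derivative of order \<open>j \<ge> 1\<close> of the arctangent at \<open>x\<close> has the closed
  form \<open>(j - 1)! * cos y ^ j * sin (j * (y + pi / 2))\<close>; the chain rule for the affine
  argument contributes the powers of \<open>2 k\<close>.\<close>

lemma smooth_curve_arctan:
  "smooth_curve_on S (\<lambda>t. arctan (k * (2 * t - 1)))"
proof -
  define y where "y t = arctan (k * (2 * t - 1))" for t :: real
  define D where "D j t = (if j = 0 then y t else
      (2 * k) ^ j * fact (j - 1) * cos (y t) ^ j * sin (real j * (y t + pi / 2)))" for j t
  have y': "(y has_real_derivative 2 * k * (cos (y t))\<^sup>2) (at t within S)" for t
    unfolding y_def cos_arctan
    by (auto intro!: derivative_eq_intros simp: power_divide inverse_eq_divide)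
  have "(D j has_vector_derivative D (Suc j) t) (at t within S)" for j t
  proof (cases j)
    case 0
    then have "D j = y" "D (Suc j) t = 2 * k * (cos (y t))\<^sup>2"
      by (auto simp: D_def sin_add power2_eq_square)
    then show ?thesis
      using y' by (simp add: has_real_derivative_iff_has_vector_derivative)
  next
    case (Suc i)
    let ?z = "real j * (y t + pi / 2)"
    have "real (Suc j) * (y t + pi / 2) = (?z + y t) + pi / 2"
      by (simp add: algebra_simps)
    then have angle: "sin (real (Suc j) * (y t + pi / 2)) = cos ?z * cos (y t) - sin ?z * sin (y t)"
      by (simp add: sin_add[of _ "pi / 2"] cos_add[of ?z])
    define z where "z t = real j * (y t + pi / 2)" for t
    have z': "(z has_real_derivative real j * (2 * k * (cos (y t))\<^sup>2)) (at t within S)"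
      unfolding z_def by (auto intro!: derivative_eq_intros y')
    have c': "((\<lambda>t. cos (y t) ^ j) has_real_derivative
        real j * (- sin (y t) * (2 * k * (cos (y t))\<^sup>2) * cos (y t) ^ i)) (at t within S)"
      using DERIV_power_Suc[OF DERIV_chain2[OF DERIV_cos y'], of i] Suc by simp
    have "D (Suc j) t = (2 * k) ^ Suc j * fact j * cos (y t) ^ Suc j
        * (cos (z t) * cos (y t) - sin (z t) * sin (y t))"
      using angle by (simp add: D_def z_def)
    also have "\<dots> = (2 * k) ^ j * fact (j - 1)
        * (real j * (- sin (y t) * (2 * k * (cos (y t))\<^sup>2) * cos (y t) ^ i)) * sin (z t)
      + cos (z t) * (real j * (2 * k * (cos (y t))\<^sup>2))
        * ((2 * k) ^ j * fact (j - 1) * cos (y t) ^ j)"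
      using Suc by (simp add: algebra_simps power2_eq_square)
    finally have "((\<lambda>t. (2 * k) ^ j * fact (j - 1) * cos (y t) ^ j * sin (z t))
        has_real_derivative D (Suc j) t) (at t within S)"
      using DERIV_mult[OF DERIV_cmult[OF c', of "(2 * k) ^ j * fact (j - 1)"]
          DERIV_chain2[OF DERIV_sin z']] by (simp only:)
    then show ?thesis
      using Suc by (simp add: has_real_derivative_iff_has_vector_derivative D_def[abs_def] z_def)
  qed
  then show ?thesis
    unfolding smooth_curve_on_def y_def[symmetric] by (intro exI[of _ D]) (simp add: D_def)
qed

section \<open>Normalised segments\<close>

lemma invertible_nonzero:
  assumes "invertible (A :: complex^'n^'n)"
  shows "A \<noteq> 0"
proof
  assume "A = 0"
  with assms have "(0 :: complex^'n^'n) = mat 1"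
    by (auto simp: invertible_def matrix_mul_zero)
  then have "(0 :: complex^'n^'n) $ i $ i = mat 1 $ i $ i" for i :: 'n
    by simp
  then show False
    by (simp add: mat_def)
qed

text \<open>Normalising a line orthogonal to \<open>M\<close> traces the great circle through the directions of \<open>M\<close>
  and \<open>D\<close>, with the tangent of the angle proportional to the line parameter.\<close>

lemma great_circle_arctan:
  fixes M D :: "complex^'n^'n"
  assumes "M \<noteq> 0" "D \<noteq> 0" "inner M D = 0"
  shows "great_circle ((1 / norm M) *\<^sub>R M) ((1 / norm D) *\<^sub>R D) (arctan (norm D / norm M * r))
    = (1 / norm (M + r *\<^sub>R D)) *\<^sub>R (M + r *\<^sub>R D)"
proof -
  let ?k = "norm D / norm M"
  let ?q = "sqrt (1 + (?k * r)\<^sup>2)"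
  have "(norm (M + r *\<^sub>R D))\<^sup>2 = (norm M)\<^sup>2 + r\<^sup>2 * (norm D)\<^sup>2"
    using norm_diff_scaleR_squared[of M "- r" D] assms(3) by simp
  also have "\<dots> = (norm M)\<^sup>2 * (1 + (?k * r)\<^sup>2)"
    using assms(1) by (simp add: field_simps)
  also have "\<dots> = (norm M * ?q)\<^sup>2"
    by (simp add: power_mult_distrib)
  finally have norm_eq: "norm (M + r *\<^sub>R D) = norm M * ?q"
    by (simp add: power2_eq_iff_nonneg)
  have "?k * r / ?q * (1 / norm D) = r / (norm M * ?q)"
    using assms(2) by simp
  then show ?thesis
    unfolding great_circle_def cos_arctan sin_arctan norm_eq
    by (simp add: scaleR_right_distrib mult.commute)
qed

lemma segment_eq_midpoint:
  fixes A B :: "'a::real_vector"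
  shows "(1 - t) *\<^sub>R A + t *\<^sub>R B
    = (1/2) *\<^sub>R (A + B) + (2 * t - 1) *\<^sub>R ((1/2) *\<^sub>R (B - A))"
proof -
  have "(1/2) *\<^sub>R (A + B) + (2 * t - 1) *\<^sub>R ((1/2) *\<^sub>R (B - A))
      = (1/2 - (2 * t - 1) / 2) *\<^sub>R A + (1/2 + (2 * t - 1) / 2) *\<^sub>R B"
    by (simp add: scaleR_right_distrib scaleR_right_diff_distrib scaleR_left_distrib
        scaleR_left_diff_distrib)
  moreover have "1/2 - (2 * t - 1) / 2 = 1 - t" "1/2 + (2 * t - 1) / 2 = t"
    by (simp_all add: field_simps)
  ultimately show ?thesis
    by simp
qed

text \<open>The end points are unit vectors, so the midpoint \<open>M\<close> of the segment is orthogonal to its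
  half-difference \<open>D\<close>, and \<open>adj M ** D\<close> is Hermitian because \<open>adj A ** B\<close> is. Measured from the
  midpoint, the segment is therefore an arctangent reparametrisation of a horizontal great circle. If
  \<open>D = 0\<close>, the curve is constant.\<close>

lemma normalised_segment_geodesic:
  fixes A B :: "complex^'n^'n"
  defines "g \<equiv> \<lambda>t. (1 - t) *\<^sub>R A + t *\<^sub>R B"
  assumes norms: "norm A = 1" "norm B = 1" and herm: "adj A ** B = adj B ** A"
    and inv: "\<And>t. t \<in> {0..1} \<Longrightarrow> invertible (g t)"
    and \<delta>: "\<And>t. t \<in> {0..1} \<Longrightarrow>
      \<delta> t = ((1 / norm (g t)) *\<^sub>R g t) ** adj ((1 / norm (g t)) *\<^sub>R g t)"
  shows "unnormalised_geodesic density_matrices traceless_hermitian bw_metric \<delta>"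
proof -
  define M where "M = (1/2) *\<^sub>R (A + B)"
  define D where "D = (1/2) *\<^sub>R (B - A)"
  have g: "g t = M + (2 * t - 1) *\<^sub>R D" for t
    unfolding g_def M_def D_def by (rule segment_eq_midpoint)
  have orth: "inner M D = 0"
    using norms by (simp add: M_def D_def inner_add_left inner_diff_right inner_commute[of B A]
        norm_eq_sqrt_inner)
  have M: "M \<noteq> 0"
    using invertible_nonzero[OF inv[of "1/2"]] g[of "1/2"] by simp
  show ?thesis
  proof (cases "D = 0")
    case True
    then have gA: "g t = A" for t
      using g[of t] g[of 0] by (simp add: g_def)
    have "A ** adj A \<in> density_matrices"
      using mult_adj_posdef[of A] inv[of 0] norms
      by (simp add: gA density_matrices_def trace_mult_adj norm_eq_sqrt_inner)
    then have "geodesic_on density_matrices traceless_hermitian bw_metric {0..1} (\<lambda>s. A ** adj A)"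
      by (rule constant_geodesic) simp
    moreover have "smooth_curve_on {0..1} (\<lambda>t::real. t)"
      unfolding smooth_curve_on_def
    proof (intro exI[of _ "\<lambda>k t. if k = 0 then t else if k = 1 then 1 else 0"] conjI allI ballI)
      fix k :: nat and t :: real
      show "((\<lambda>t. if k = 0 then t else if k = 1 then 1 else 0) has_vector_derivative
          (if Suc k = 0 then t else if Suc k = 1 then 1 else 0)) (at t within {0..1})"
        by (cases "k = 0") simp_all
    qed simp
    moreover have "velocity {0..1} (\<lambda>t::real. t) t = 1" if "t \<in> {0..1}" for t
      using that by (intro velocityI) simp_all
    ultimately show ?thesis
      unfolding unnormalised_geodesic_def using \<delta> norms
      by (intro exI[of _ 0] exI[of _ 1] exI[of _ "\<lambda>t. t"] exI[of _ "\<lambda>s. A ** adj A"]) (simp add: gA)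
  next
    case False
    define k where "k = norm D / norm M"
    have k: "0 < k"
      using M False by (simp add: k_def)
    define P where "P = (1 / norm M) *\<^sub>R M"
    define Q where "Q = (1 / norm D) *\<^sub>R D"
    have circle: "great_circle P Q (arctan (k * (2 * t - 1))) = (1 / norm (g t)) *\<^sub>R g t" for t
      unfolding P_def Q_def k_def g using M False orth by (rule great_circle_arctan)
    have "geodesic_on density_matrices traceless_hermitian bw_metric {arctan (- k)..arctan k}
        (\<lambda>s. great_circle P Q s ** adj (great_circle P Q s))"
    proof (rule great_circle_geodesic)
      show "arctan (- k) < arctan k"
        using k by (simp add: arctan_less_iff)
      show "inner P P = 1" "inner Q Q = 1" "inner P Q = 0"
        using M False orth by (simp_all add: P_def Q_def dot_square_norm power2_eq_square)
      have "adj M ** D = adj D ** M"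
        by (simp add: M_def D_def adj_simps matrix_ring_simps herm
            scaleR_right_distrib scaleR_right_diff_distrib)
      then show "adj P ** Q = adj Q ** P"
        by (simp add: P_def Q_def adj_simps matrix_ring_simps mult.commute)
      fix s assume s: "s \<in> {arctan (- k)..arctan k}"
      then have "- (pi / 2) < s" "s < pi / 2"
        using arctan_lbound[of "- k"] arctan_ubound[of k] by auto
      then have arctan_s: "arctan (tan s) = s"
        by (rule arctan_tan)
      with s have "- k \<le> tan s" "tan s \<le> k"
        by (metis arctan_le_iff atLeastAtMost_iff)+
      \<comment> \<open>Every point of the arc comes from a point of the segment, where invertibility is assumed.\<close>
      define t where "t = (1 + tan s / k) / 2"
      have "t \<in> {0..1}"
        using \<open>- k \<le> tan s\<close> \<open>tan s \<le> k\<close> k by (simp add: t_def field_simps)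
      moreover have "k * (2 * t - 1) = tan s"
        using k by (simp add: t_def field_simps)
      ultimately show "invertible (great_circle P Q s)"
        using circle[of t] inv[of t] arctan_s
        by (simp add: scalar_invertible invertible_nonzero)
    qed
    moreover have "velocity {0..1} (\<lambda>t. arctan (k * (2 * t - 1))) t > 0" if "t \<in> {0..1}" for t
    proof -
      let ?v = "2 * k / (1 + (k * (2 * t - 1))\<^sup>2)"
      have "((\<lambda>t. arctan (k * (2 * t - 1))) has_vector_derivative ?v) (at t within {0..1})"
        unfolding has_real_derivative_iff_has_vector_derivative[symmetric]
        by (auto intro!: derivative_eq_intros simp: inverse_eq_divide)
      from velocityI[OF _ that this] show ?thesis
        using k by (simp add: add_pos_nonneg)
    qed
    ultimately show ?thesis
      unfolding unnormalised_geodesic_def using \<delta> circle k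
      by (intro exI[of _ "arctan (- k)"] exI[of _ "arctan k"] exI[of _ "\<lambda>t. arctan (k * (2 * t - 1))"]
          exI[of _ "\<lambda>s. great_circle P Q s ** adj (great_circle P Q s)"])
        (simp add: smooth_curve_arctan arctan_less_iff)
  qed
qed

section \<open>Aligned square roots\<close>

lemma posdef_congruence:
  assumes "P \<in> posdef_matrices" "invertible V"
  shows "adj V ** P ** V \<in> posdef_matrices"
proof -
  have "V *v x \<noteq> 0" if "x \<noteq> 0" for x
    using assms(2) that by (metis invertible_def matrix_left_invertible_ker)
  moreover have "inner x ((adj V ** P ** V) *v x) = inner (V *v x) (P *v (V *v x))" for x
    by (simp add: matrix_vector_mul_assoc[symmetric] inner_matrix_vector)
  ultimately show ?thesis
    using assms(1) by (simp add: posdef_iff adj_mult matrix_mul_assoc)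
qed

lemma posdef_convex:
  assumes "A \<in> posdef_matrices" "B \<in> posdef_matrices" "t \<in> {0..1}"
  shows "(1 - t) *\<^sub>R A + t *\<^sub>R B \<in> posdef_matrices"
proof -
  have "0 < (1 - t) * inner x (A *v x) + t * inner x (B *v x)" if "x \<noteq> 0" for x
  proof -
    have "0 < inner x (A *v x)" "0 < inner x (B *v x)"
      using assms that by (auto simp: posdef_iff)
    then show ?thesis
      using assms(3) by (cases "t = 0") (auto intro: add_nonneg_pos)
  qed
  then show ?thesis
    using assms by (simp add: posdef_iff adj_simps matrix_vector_mult_add_rdistrib
        scaleR_matrix_vector inner_add_right)
qed

theorem theorem7:
  fixes \<rho>\<^sub>1 \<rho>\<^sub>2 U V :: "complex^'n^'n"
    and \<gamma> \<gamma>\<^sub>1 :: "real \<Rightarrow> complex^'n^'n"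
    and \<pi> :: "complex^'n^'n \<Rightarrow> complex^'n^'n"
  assumes "\<rho>\<^sub>1 \<in> density_matrices" and "\<rho>\<^sub>2 \<in> density_matrices"
    and "unitary U" and "unitary V"
    and "U ** adj V = polar_factor (posdef_sqrt \<rho>\<^sub>2 ** posdef_sqrt \<rho>\<^sub>1)"
    and "\<And>t. t \<in> {0..1} \<Longrightarrow>
      \<gamma> t = (1 - t) *\<^sub>R (posdef_sqrt \<rho>\<^sub>1 ** V) + t *\<^sub>R (posdef_sqrt \<rho>\<^sub>2 ** U)"
    and "\<And>t. t \<in> {0..1} \<Longrightarrow> \<gamma>\<^sub>1 t = (1 / hs_norm (\<gamma> t)) *\<^sub>R \<gamma> t"
    and "\<And>M. invertible M \<Longrightarrow> \<pi> M = M ** adj M"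
  shows "(\<forall>t\<in>{0..1}. invertible (\<gamma>\<^sub>1 t)) \<and>
    unnormalised_geodesic_between density_matrices traceless_hermitian bw_metric \<rho>\<^sub>1 \<rho>\<^sub>2 (\<pi> \<circ> \<gamma>\<^sub>1)"
proof -
  define R where "R = posdef_sqrt \<rho>\<^sub>1"
  define S where "S = posdef_sqrt \<rho>\<^sub>2"
  have R: "R \<in> posdef_matrices" "R ** R = \<rho>\<^sub>1" and S: "S \<in> posdef_matrices" "S ** S = \<rho>\<^sub>2"
    using assms(1,2) posdef_sqrt by (auto simp: R_def S_def density_matrices_def)
  have U: "U ** adj U = mat 1" "adj U ** U = mat 1" and V: "V ** adj V = mat 1" "adj V ** V = mat 1"
    using assms(3,4) by (auto simp: unitary_def)
  have V_inv: "invertible V"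
    using V by (auto simp: invertible_def)
  define A where "A = R ** V"
  define B where "B = S ** U"
  have "A ** adj A = R ** (V ** adj V) ** R"
    by (simp add: A_def adj_mult posdef_adj R matrix_mul_assoc)
  then have A: "A ** adj A = \<rho>\<^sub>1"
    by (simp add: V R)
  have "B ** adj B = S ** (U ** adj U) ** S"
    by (simp add: B_def adj_mult posdef_adj S matrix_mul_assoc)
  then have B: "B ** adj B = \<rho>\<^sub>2"
    by (simp add: U S)
  have norms: "norm A = 1" "norm B = 1"
    using trace_mult_adj[of A] trace_mult_adj[of B] assms(1,2)
    by (simp_all add: A B density_matrices_def norm_eq_sqrt_inner)
  have "invertible (S ** R)"
    by (intro invertible_mult posdef_invertible R S)
  then obtain P where P: "P \<in> posdef_matrices" "S ** R = polar_factor (S ** R) ** P"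
    by (rule polar_decomposition)
  \<comment> \<open>The alignment of the frames: the polar factor cancels in \<open>adj A ** B\<close>, and
    a congruence of the positive part remains.\<close>
  have SR: "S ** R = U ** adj V ** P"
    using P(2) assms(5) by (simp add: R_def S_def)
  have "adj A ** B = adj V ** adj (S ** R) ** U"
    by (simp add: A_def B_def adj_mult posdef_adj R S matrix_mul_assoc)
  also have "\<dots> = adj V ** P ** V ** (adj U ** U)"
    unfolding SR by (simp add: adj_mult posdef_adj P matrix_mul_assoc)
  finally have AB: "adj A ** B = adj V ** P ** V"
    by (simp add: U)
  have AB_posdef: "adj A ** B \<in> posdef_matrices"
    unfolding AB by (rule posdef_congruence[OF P(1) V_inv])
  have herm: "adj A ** B = adj B ** A"
    using posdef_adj[OF AB_posdef] by (simp add: adj_mult)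
  have "invertible A"
    unfolding A_def by (intro invertible_mult posdef_invertible R V_inv)
  then have AA: "adj A ** A \<in> posdef_matrices"
    using mult_adj_posdef[OF invertible_adj] by fastforce
  have \<gamma>: "\<gamma> t = (1 - t) *\<^sub>R A + t *\<^sub>R B" if "t \<in> {0..1}" for t
    using assms(6)[OF that] by (simp add: A_def B_def R_def S_def)
  have inv: "invertible ((1 - t) *\<^sub>R A + t *\<^sub>R B)" if "t \<in> {0..1}" for t
  proof -
    \<comment> \<open>Left multiplication by \<open>adj A\<close> maps the segment into the convex cone of positive
      definite matrices.\<close>
    have "adj A ** ((1 - t) *\<^sub>R A + t *\<^sub>R B) \<in> posdef_matrices"
      using posdef_convex[OF AA AB_posdef that] by (simp add: matrix_ring_simps)
    from posdef_invertible[OF this] show ?thesis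
      unfolding invertible_left_inverse by (metis matrix_mul_assoc)
  qed
  have inv': "invertible (\<gamma>\<^sub>1 t)" if "t \<in> {0..1}" for t
  proof -
    have "invertible (\<gamma> t)"
      using inv[OF that] \<gamma>[OF that] by simp
    moreover from this have "\<gamma> t \<noteq> 0"
      by (rule invertible_nonzero)
    ultimately show ?thesis
      unfolding assms(7)[OF that] hs_norm_eq_norm by (intro scalar_invertible) simp_all
  qed
  have \<delta>: "(\<pi> \<circ> \<gamma>\<^sub>1) t = ((1 / norm ((1 - t) *\<^sub>R A + t *\<^sub>R B)) *\<^sub>R ((1 - t) *\<^sub>R A + t *\<^sub>R B))
      ** adj ((1 / norm ((1 - t) *\<^sub>R A + t *\<^sub>R B)) *\<^sub>R ((1 - t) *\<^sub>R A + t *\<^sub>R B))"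
    if "t \<in> {0..1}" for t
    using assms(8)[OF inv'[OF that]] assms(7)[OF that] \<gamma>[OF that] by (simp add: hs_norm_eq_norm)
  have "unnormalised_geodesic density_matrices traceless_hermitian bw_metric (\<pi> \<circ> \<gamma>\<^sub>1)"
    using norms herm inv \<delta> by (rule normalised_segment_geodesic)
  moreover have "(\<pi> \<circ> \<gamma>\<^sub>1) 0 = \<rho>\<^sub>1" "(\<pi> \<circ> \<gamma>\<^sub>1) 1 = \<rho>\<^sub>2"
    using \<delta>[of 0] \<delta>[of 1] by (simp_all add: norms A B)
  ultimately show ?thesis
    using inv' by (simp add: unnormalised_geodesic_between_def)
qed

end
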